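(* Let $\alpha\le\omega_1$ and let $(\tau_\xi)_{\xi<\alpha\oplus1}$ be a filtration from $\sigma$ (topologies on a set $X$) such that $\tau_\xi$ is completely metrizable for each $\xi<\alpha$. Let $E$ be an equivalence relation on $X$ all of whose equivalence classes are solid. If every equivalence class of $E$ belongs to $\bigcup_{\xi<\alpha}\mathbf\Pi^0_{1+\xi}$ with respect to $\sigma$, then $E=\bigcap_{\xi<\alpha}E_\xi$.
   Context: For an ordinal $\alpha$, $\alpha\oplus1=\alpha+1$ if $\alpha$ is a successor, and $\alpha\oplus1=\alpha$ if $\alpha=0$ or $\alpha$ is a limit. A sequence $(\tau_\xi)_{\xi<\rho}$ of topologies on $X$ is a filtration from $\sigma$ if $\sigma=\tau_0\subseteq\tau_1\subseteq\cdots$ and for each $\beta<\rho$, whenever $F$ is $\tau_\xi$-closed for some $\xi<\beta$, ${\rm int}_{\tau_\beta}(F)={\rm int}_{\tau^*}(F)$, where $\tau^*$ is the smallest topology containing all $\tau_\xi$, $\xi<\rho$. For $\xi<\rho$, $E_\xi$ is the equivalence relation $xE_\xi y\iff{\rm cl}_{\tau_\xi}([x]_E)={\rm cl}_{\tau_\xi}([y]_E)$. For $\beta<\rho$, the $\beta$-tame sets form the smallest family of subsets of $X$ containing all $\tau_\xi$-closed sets for every $\xi<\beta$ and closed under: if $\xi<\beta$, $\mathcal U$ is a $\tau_\xi$-discrete family of $\tau_\xi$-open sets and each $F^U$ ($U\in\mathcal U$) is $\beta$-tame, then $\bigcup_{U\in\mathcal U}(F^U\cap U)$ is $\beta$-tame.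 A set $A$ is $\beta$-solid if for each countable family $\mathcal F$ of $\beta$-tame sets such that $\bigcup\mathcal F$ contains a non-empty relatively $\tau_\beta$-open subset of $A$, some $F\in\mathcal F$ has ${\rm int}_{\tau_\beta}(F)\neq\emptyset$; $A$ is solid if it is $\beta$-solid for every $\beta<\rho$ (here $\rho=\alpha\oplus1$). With respect to $\sigma$: $\mathbf\Pi^0_1$ is the family of $\sigma$-closed sets and for $\xi\ge1$, $\mathbf\Pi^0_{1+\xi}$ consists of complements of countable unions of sets in $\bigcup_{\gamma<\xi}\mathbf\Pi^0_{1+\gamma}$. *)

theory Defs
  imports "HOL-Analysis.Analysis"
begin

text \<open>
  Ordinals are elements of an arbitrary type of class \<open>wellorder\<close>: the element \<open>\<alpha>\<close> stands for the
  order type of \<open>{..<\<alpha>}\<close>. Every ordinal is represented in a suitable such type. An index set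
  \<open>{\<xi>. \<xi> < \<rho>}\<close> is given as the set \<open>R\<close> of its elements, so that \<open>\<rho>\<close> itself (for instance
  \<open>\<alpha> + 1\<close>) need not be an element of the type.
\<close>

definition ord_zero :: "'i::wellorder" where
  "ord_zero = (LEAST \<xi>. True)"

definition is_successor :: "'i::wellorder \<Rightarrow> bool" where
  "is_successor \<alpha> \<longleftrightarrow> (\<exists>\<beta><\<alpha>. \<forall>\<gamma><\<alpha>. \<gamma> \<le> \<beta>)"

text \<open>The ordinals below \<open>\<alpha> \<oplus> 1\<close>; here \<open>{..\<alpha>}\<close> are those below \<open>\<alpha> + 1\<close>.\<close>

definition below_oplus1 :: "'i::wellorder \<Rightarrow> 'i set" where
  "below_oplus1 \<alpha> = (if is_successor \<alpha> then {..\<alpha>} else {..<\<alpha>})"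

text \<open>
  The well-order of \<open>{..<\<alpha>}\<close> is compared with the initial ordinal \<open>cardSuc natLeq\<close>,
  which has order type \<open>\<omega>\<^sub>1\<close>.
\<close>

definition le_omega1 :: "'i::wellorder \<Rightarrow> bool" where
  "le_omega1 \<alpha> \<longleftrightarrow> ({(\<xi>, \<eta>). \<xi> \<le> \<eta> \<and> \<eta> < \<alpha>}, cardSuc natLeq) \<in> ordLeq"

definition sup_topology :: "'i set \<Rightarrow> ('i \<Rightarrow> 'a topology) \<Rightarrow> 'a topology" where
  "sup_topology R \<tau> = topology_generated_by {U. \<exists>\<xi>\<in>R. openin (\<tau> \<xi>) U}"

definition filtration_from ::
    "'a set \<Rightarrow> 'a topology \<Rightarrow> 'i::wellorder set \<Rightarrow> ('i \<Rightarrow> 'a topology) \<Rightarrow> bool" where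
  "filtration_from X \<sigma> R \<tau> \<longleftrightarrow>
     topspace \<sigma> = X \<and>
     (\<forall>\<xi>\<in>R. topspace (\<tau> \<xi>) = X) \<and>
     (ord_zero \<in> R \<longrightarrow> \<tau> ord_zero = \<sigma>) \<and>
     (\<forall>\<xi>\<in>R. \<forall>\<eta>\<in>R. \<xi> \<le> \<eta> \<longrightarrow> (\<forall>U. openin (\<tau> \<xi>) U \<longrightarrow> openin (\<tau> \<eta>) U)) \<and>
     (\<forall>\<beta>\<in>R. \<forall>F. (\<exists>\<xi><\<beta>. closedin (\<tau> \<xi>) F) \<longrightarrow>
        (\<tau> \<beta>) interior_of F = (sup_topology R \<tau>) interior_of F)"

definition closure_equiv ::
    "'a set \<Rightarrow> ('i \<Rightarrow> 'a topology) \<Rightarrow> ('a \<times> 'a) set \<Rightarrow> 'i \<Rightarrow> ('a \<times> 'a) set" where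
  "closure_equiv X \<tau> E \<xi> =
     {(x, y). x \<in> X \<and> y \<in> X \<and> (\<tau> \<xi>) closure_of (E `` {x}) = (\<tau> \<xi>) closure_of (E `` {y})}"

definition discrete_family_in :: "'a topology \<Rightarrow> 'a set set \<Rightarrow> bool" where
  "discrete_family_in T \<U> \<longleftrightarrow>
     (\<forall>x\<in>topspace T. \<exists>V. openin T V \<and> x \<in> V \<and> (\<exists>\<^sub>\<le>\<^sub>1U. U \<in> \<U> \<and> U \<inter> V \<noteq> {}))"

inductive_set tame :: "('i::wellorder \<Rightarrow> 'a topology) \<Rightarrow> 'i \<Rightarrow> 'a set set"
  for \<tau> :: "'i::wellorder \<Rightarrow> 'a topology" and \<beta> :: 'i where
  closed: "\<xi> < \<beta> \<Longrightarrow> closedin (\<tau> \<xi>) F \<Longrightarrow> F \<in> tame \<tau> \<beta>"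
| discrete_union:
    "\<xi> < \<beta> \<Longrightarrow> (\<And>U. U \<in> \<U> \<Longrightarrow> openin (\<tau> \<xi>) U) \<Longrightarrow> discrete_family_in (\<tau> \<xi>) \<U> \<Longrightarrow>
     (\<And>U. U \<in> \<U> \<Longrightarrow> F U \<in> tame \<tau> \<beta>) \<Longrightarrow> (\<Union>U\<in>\<U>. F U \<inter> U) \<in> tame \<tau> \<beta>"

definition solid_at :: "('i::wellorder \<Rightarrow> 'a topology) \<Rightarrow> 'i \<Rightarrow> 'a set \<Rightarrow> bool" where
  "solid_at \<tau> \<beta> A \<longleftrightarrow>
     (\<forall>\<F>. countable \<F> \<and> \<F> \<subseteq> tame \<tau> \<beta> \<and>
        (\<exists>V. openin (subtopology (\<tau> \<beta>) A) V \<and> V \<noteq> {} \<and> V \<subseteq> \<Union>\<F>) \<longrightarrow>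
        (\<exists>F\<in>\<F>. (\<tau> \<beta>) interior_of F \<noteq> {}))"

definition solid :: "'i::wellorder set \<Rightarrow> ('i \<Rightarrow> 'a topology) \<Rightarrow> 'a set \<Rightarrow> bool" where
  "solid R \<tau> A \<longleftrightarrow> (\<forall>\<beta>\<in>R. solid_at \<tau> \<beta> A)"

text \<open>\<open>Pi0 \<sigma> \<xi>\<close> is the class \<open>\<Pi>\<^sup>0\<close> with index \<open>1 + \<xi>\<close> (not \<open>\<xi>\<close>) of the topology \<open>\<sigma>\<close>.\<close>

function Pi0 :: "'a topology \<Rightarrow> 'i::wellorder \<Rightarrow> 'a set set" where
  "Pi0 \<sigma> \<xi> =
     (if \<xi> = ord_zero then {C. closedin \<sigma> C}
      else {topspace \<sigma> - \<Union>\<A> | \<A>. countable \<A> \<and> \<A> \<subseteq> (\<Union>\<gamma>\<in>{..<\<xi>}. Pi0 \<sigma> \<gamma>)})"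
  by pat_completeness auto
termination
  by (relation "inv_image {(x, y). x < y} snd") (auto intro: wf_inv_image wf)

declare Pi0.simps [simp del]

end

theory Submission
  imports Defs
begin

text \<open>
  Fix \<open>\<beta>\<close> and call a set meagre if countably many \<open>\<beta>\<close>-tame sets with empty \<open>\<tau>\<^sub>\<beta>\<close>-interior cover it.
  For \<open>\<xi> < \<beta>\<close>, every set in \<open>\<Pi>\<^sup>0\<close> with index \<open>1 + \<xi>\<close> equals some \<open>\<tau>\<^sub>\<xi>\<close>-closed set modulo meagre
  sets: if \<open>F\<close> is \<open>\<tau>\<^sub>\<gamma>\<close>-closed with \<open>\<gamma> < \<xi>\<close>, then its \<open>\<tau>\<^sub>\<xi>\<close>- and \<open>\<tau>\<^sub>\<beta>\<close>-interiors coincide, so \<open>F\<close>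
  minus its \<open>\<tau>\<^sub>\<xi>\<close>-interior is \<open>\<tau>\<^sub>\<xi>\<close>-closed with empty \<open>\<tau>\<^sub>\<beta>\<close>-interior, hence meagre.
  Now let \<open>C\<close> and \<open>D\<close> be disjoint classes with the same \<open>\<tau>\<^sub>\<xi>\<close>-closure and let \<open>F\<close> approximate \<open>C\<close> in this
  way. The set \<open>C - F\<close> is meagre and relatively open in the solid set \<open>C\<close>, hence empty, so
  \<open>D\<close> is contained in the \<open>\<tau>\<^sub>\<xi>\<close>-closure of \<open>C\<close> and thus in \<open>F - C\<close>, which is meagre,
  contradicting the solidity of \<open>D\<close>.
\<close>

definition tame_meagre :: "('i::wellorder \<Rightarrow> 'a topology) \<Rightarrow> 'i \<Rightarrow> 'a set \<Rightarrow> bool" where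
  "tame_meagre \<tau> \<beta> S \<longleftrightarrow>
     (\<exists>\<F>. countable \<F> \<and> \<F> \<subseteq> tame \<tau> \<beta> \<and> (\<forall>F\<in>\<F>. \<tau> \<beta> interior_of F = {}) \<and> S \<subseteq> \<Union>\<F>)"

lemma tame_meagre_subset: "tame_meagre \<tau> \<beta> T \<Longrightarrow> S \<subseteq> T \<Longrightarrow> tame_meagre \<tau> \<beta> S"
  unfolding tame_meagre_def by (meson order_trans)

lemma tame_meagre_tame: "F \<in> tame \<tau> \<beta> \<Longrightarrow> \<tau> \<beta> interior_of F = {} \<Longrightarrow> tame_meagre \<tau> \<beta> F"
  unfolding tame_meagre_def by (rule exI[of _ "{F}"]) simp

lemma tame_meagre_UN:
  assumes "countable I" and "\<And>i. i \<in> I \<Longrightarrow> tame_meagre \<tau> \<beta> (S i)"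
  shows "tame_meagre \<tau> \<beta> (\<Union>i\<in>I. S i)"
proof -
  have "\<forall>i\<in>I. \<exists>\<F>. countable \<F> \<and> \<F> \<subseteq> tame \<tau> \<beta> \<and> (\<forall>F\<in>\<F>. \<tau> \<beta> interior_of F = {}) \<and> S i \<subseteq> \<Union>\<F>"
    using assms(2) unfolding tame_meagre_def by (rule ballI)
  then obtain \<F> where \<F>: "\<forall>i\<in>I. countable (\<F> i) \<and> \<F> i \<subseteq> tame \<tau> \<beta> \<and>
      (\<forall>F\<in>\<F> i. \<tau> \<beta> interior_of F = {}) \<and> S i \<subseteq> \<Union>(\<F> i)"
    by (rule bchoice[THEN exE])
  show ?thesis
    unfolding tame_meagre_def
  proof (intro exI conjI)
    show "countable (\<Union>i\<in>I. \<F> i)"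
      using assms(1) \<F> by simp
    have "(\<Union>i\<in>I. S i) \<subseteq> (\<Union>i\<in>I. \<Union>(\<F> i))"
      using \<F> by (simp add: UN_mono)
    also have "\<dots> = \<Union>(\<Union>i\<in>I. \<F> i)"
      by blast
    finally show "(\<Union>i\<in>I. S i) \<subseteq> \<Union>(\<Union>i\<in>I. \<F> i)" .
  qed (use \<F> in auto)
qed

lemma tame_meagre_empty: "tame_meagre \<tau> \<beta> {}"
  using tame_meagre_UN[of "{}"] by simp

lemma tame_meagre_Un:
  "tame_meagre \<tau> \<beta> S \<Longrightarrow> tame_meagre \<tau> \<beta> T \<Longrightarrow> tame_meagre \<tau> \<beta> (S \<union> T)"
  using tame_meagre_UN[of "{S, T}" \<tau> \<beta> id] by auto

definition eq_mod_meagre ::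
    "('i::wellorder \<Rightarrow> 'a topology) \<Rightarrow> 'i \<Rightarrow> 'a set \<Rightarrow> 'a set \<Rightarrow> bool" where
  "eq_mod_meagre \<tau> \<beta> A B \<longleftrightarrow> tame_meagre \<tau> \<beta> (sym_diff A B)"

lemma eq_mod_meagre_refl: "eq_mod_meagre \<tau> \<beta> A A"
  by (simp add: eq_mod_meagre_def tame_meagre_empty)

lemma eq_mod_meagre_trans:
  assumes "eq_mod_meagre \<tau> \<beta> A B" "eq_mod_meagre \<tau> \<beta> B C"
  shows "eq_mod_meagre \<tau> \<beta> A C"
proof -
  have "sym_diff A C \<subseteq> sym_diff A B \<union> sym_diff B C"
    by blast
  then show ?thesis
    using assms unfolding eq_mod_meagre_def by (blast intro: tame_meagre_subset tame_meagre_Un)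
qed

lemma eq_mod_meagre_Diff:
  assumes "eq_mod_meagre \<tau> \<beta> A B"
  shows "eq_mod_meagre \<tau> \<beta> (X - A) (X - B)"
  using assms unfolding eq_mod_meagre_def by (rule tame_meagre_subset) blast

lemma eq_mod_meagre_UN:
  assumes "countable I" and "\<And>i. i \<in> I \<Longrightarrow> eq_mod_meagre \<tau> \<beta> (A i) (B i)"
  shows "eq_mod_meagre \<tau> \<beta> (\<Union>i\<in>I. A i) (\<Union>i\<in>I. B i)"
proof -
  have "tame_meagre \<tau> \<beta> (\<Union>i\<in>I. sym_diff (A i) (B i))"
    using assms unfolding eq_mod_meagre_def by (rule tame_meagre_UN)
  then show ?thesis
    unfolding eq_mod_meagre_def by (rule tame_meagre_subset) blast
qed

lemma solid_at_subset_closedin: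
  assumes "solid_at \<tau> \<beta> A" "A \<subseteq> topspace (\<tau> \<beta>)" "closedin (\<tau> \<beta>) F" "tame_meagre \<tau> \<beta> (A - F)"
  shows "A \<subseteq> F"
proof -
  have "A - F = (topspace (\<tau> \<beta>) - F) \<inter> A"
    using assms(2) by blast
  then have "openin (subtopology (\<tau> \<beta>) A) (A - F)"
    using assms(3) by (auto simp: openin_subtopology)
  then have "A - F = {}"
    using assms(1,4) unfolding solid_at_def tame_meagre_def by blast
  then show ?thesis
    by blast
qed

lemma solid_at_tame_meagre_imp_empty:
  assumes "solid_at \<tau> \<beta> A" "A \<subseteq> topspace (\<tau> \<beta>)" "tame_meagre \<tau> \<beta> A"
  shows "A = {}"
  using solid_at_subset_closedin[of \<tau> \<beta> A "{}"] assms by simp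

lemma Pi0_induct [consumes 1, case_names closed compl_Union]:
  assumes "A \<in> Pi0 \<sigma> \<xi>"
    and closed: "\<And>F. closedin \<sigma> F \<Longrightarrow> P ord_zero F"
    and compl_Union: "\<And>\<xi> \<A>. countable \<A> \<Longrightarrow> (\<And>B. B \<in> \<A> \<Longrightarrow> \<exists>\<gamma><\<xi>. P \<gamma> B) \<Longrightarrow>
      P \<xi> (topspace \<sigma> - \<Union>\<A>)"
  shows "P \<xi> A"
  using assms(1)
proof (induction \<xi> arbitrary: A rule: less_induct)
  case (less \<xi>)
  show ?case
  proof (cases "\<xi> = ord_zero")
    case True
    then show ?thesis
      using less.prems closed by (simp add: Pi0.simps[of \<sigma> ord_zero])
  next
    case False
    then obtain \<A> where \<A>: "countable \<A>" "\<A> \<subseteq> (\<Union>\<gamma>\<in>{..<\<xi>}. Pi0 \<sigma> \<gamma>)" "A = topspace \<sigma> - \<Union>\<A>"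
      using less.prems by (auto simp: Pi0.simps[of \<sigma> \<xi>])
    have "\<exists>\<gamma><\<xi>. P \<gamma> B" if "B \<in> \<A>" for B
      using that \<A>(2) less.IH by blast
    then show ?thesis
      using compl_Union \<A>(1) unfolding \<A>(3) by blast
  qed
qed

lemma Pi0_subset_topspace: "A \<in> Pi0 \<sigma> \<xi> \<Longrightarrow> A \<subseteq> topspace \<sigma>"
  by (induction rule: Pi0_induct) (auto dest: closedin_subset)

locale filtration =
  fixes X :: "'a set" and \<sigma> :: "'a topology"
    and R :: "'i::wellorder set" and \<tau> :: "'i \<Rightarrow> 'a topology"
  assumes is_filtration: "filtration_from X \<sigma> R \<tau>"
    and index_downward: "\<xi> < \<beta> \<Longrightarrow> \<beta> \<in> R \<Longrightarrow> \<xi> \<in> R"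
begin

lemma topspace_base: "topspace \<sigma> = X"
  using is_filtration by (simp add: filtration_from_def)

lemma topspace_index: "\<xi> \<in> R \<Longrightarrow> topspace (\<tau> \<xi>) = X"
  using is_filtration by (simp add: filtration_from_def)

lemma topology_ord_zero: "ord_zero \<in> R \<Longrightarrow> \<tau> ord_zero = \<sigma>"
  using is_filtration by (simp add: filtration_from_def)

lemma closedin_mono:
  assumes "closedin (\<tau> \<xi>) F" "\<xi> < \<eta>" "\<eta> \<in> R"
  shows "closedin (\<tau> \<eta>) F"
  using assms is_filtration index_downward[OF assms(2,3)]
  unfolding filtration_from_def closedin_def by simp

lemma interior_of_closedin_eq_sup:
  assumes "closedin (\<tau> \<gamma>) F" "\<gamma> < \<xi>" "\<xi> \<in> R"
  shows "\<tau> \<xi> interior_of F = sup_topology R \<tau> interior_of F"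
proof -
  have "\<exists>\<gamma><\<xi>. closedin (\<tau> \<gamma>) F"
    using assms(1,2) by blast
  then show ?thesis
    using is_filtration assms(3) by (simp add: filtration_from_def)
qed

lemma closedin_eq_mod_meagre_interior_of:
  assumes F: "closedin (\<tau> \<gamma>) F" and "\<gamma> < \<xi>" "\<xi> < \<beta>" "\<beta> \<in> R"
  shows "eq_mod_meagre \<tau> \<beta> F (\<tau> \<xi> interior_of F)"
proof -
  let ?B = "F - \<tau> \<xi> interior_of F"
  have \<xi>: "\<xi> \<in> R"
    using index_downward assms(3,4) .
  have "closedin (\<tau> \<xi>) ?B"
    using closedin_mono[OF F assms(2) \<xi>] by (simp add: closedin_diff)
  then have "?B \<in> tame \<tau> \<beta>"
    by (rule tame.closed[OF assms(3)])
  moreover have "\<tau> \<beta> interior_of ?B = {}"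
  proof -
    have "\<tau> \<beta> interior_of F = \<tau> \<xi> interior_of F"
      using interior_of_closedin_eq_sup[OF F] assms(2-4) \<xi> by simp
    then show ?thesis
      using interior_of_mono[of ?B F "\<tau> \<beta>"] interior_of_subset[of "\<tau> \<beta>" ?B] by blast
  qed
  ultimately have "tame_meagre \<tau> \<beta> ?B"
    by (rule tame_meagre_tame)
  moreover have "sym_diff F (\<tau> \<xi> interior_of F) = ?B"
    using interior_of_subset[of "\<tau> \<xi>" F] by blast
  ultimately show ?thesis
    by (simp add: eq_mod_meagre_def)
qed

lemma Pi0_eq_mod_meagre_closedin:
  assumes "A \<in> Pi0 \<sigma> \<xi>" "\<xi> < \<beta>" "\<beta> \<in> R"
  shows "\<exists>F. closedin (\<tau> \<xi>) F \<and> eq_mod_meagre \<tau> \<beta> A F"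
  using assms(1,2)
proof (induction rule: Pi0_induct)
  case (closed F)
  then have "closedin (\<tau> ord_zero) F"
    using topology_ord_zero index_downward assms(3) by simp
  then show ?case
    using eq_mod_meagre_refl by blast
next
  case (compl_Union \<xi> \<A>)
  have \<xi>: "\<xi> \<in> R"
    using index_downward compl_Union.prems assms(3) .
  have "\<forall>B\<in>\<A>. \<exists>U. openin (\<tau> \<xi>) U \<and> eq_mod_meagre \<tau> \<beta> B U"
  proof
    fix B assume "B \<in> \<A>"
    then obtain \<gamma> F where "\<gamma> < \<xi>" "closedin (\<tau> \<gamma>) F" and BF: "eq_mod_meagre \<tau> \<beta> B F"
      using compl_Union.IH compl_Union.prems order_less_trans by blast
    then have "eq_mod_meagre \<tau> \<beta> F (\<tau> \<xi> interior_of F)"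
      using closedin_eq_mod_meagre_interior_of compl_Union.prems assms(3) by blast
    with BF have "eq_mod_meagre \<tau> \<beta> B (\<tau> \<xi> interior_of F)"
      by (rule eq_mod_meagre_trans)
    then show "\<exists>U. openin (\<tau> \<xi>) U \<and> eq_mod_meagre \<tau> \<beta> B U"
      using openin_interior_of by blast
  qed
  then obtain U where U: "\<forall>B\<in>\<A>. openin (\<tau> \<xi>) (U B) \<and> eq_mod_meagre \<tau> \<beta> B (U B)"
    by (rule bchoice[THEN exE])
  have "eq_mod_meagre \<tau> \<beta> (\<Union>B\<in>\<A>. B) (\<Union>B\<in>\<A>. U B)"
    using compl_Union.hyps U by (intro eq_mod_meagre_UN) auto
  then have "eq_mod_meagre \<tau> \<beta> (X - \<Union>\<A>) (X - (\<Union>B\<in>\<A>. U B))"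
    unfolding image_ident by (rule eq_mod_meagre_Diff)
  moreover have "openin (\<tau> \<xi>) (\<Union>B\<in>\<A>. U B)"
    using U by (intro openin_Union) auto
  then have "closedin (\<tau> \<xi>) (X - (\<Union>B\<in>\<A>. U B))"
    using closedin_diff[OF closedin_topspace] topspace_index[OF \<xi>] by metis
  ultimately show ?case
    unfolding topspace_base by blast
qed

lemma solid_at_Pi0_closure_of_Diff_meagre:
  assumes "C \<in> Pi0 \<sigma> \<xi>" "solid_at \<tau> \<beta> C" "\<xi> < \<beta>" "\<beta> \<in> R"
  shows "tame_meagre \<tau> \<beta> (\<tau> \<xi> closure_of C - C)"
proof -
  obtain F where F: "closedin (\<tau> \<xi>) F" "tame_meagre \<tau> \<beta> (sym_diff C F)"
    using Pi0_eq_mod_meagre_closedin assms unfolding eq_mod_meagre_def by blast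
  have "C \<subseteq> F"
  proof (rule solid_at_subset_closedin[OF assms(2)])
    show "C \<subseteq> topspace (\<tau> \<beta>)"
      using Pi0_subset_topspace[OF assms(1)] topspace_base topspace_index[OF assms(4)] by simp
    show "closedin (\<tau> \<beta>) F"
      using closedin_mono F(1) assms(3,4) .
    show "tame_meagre \<tau> \<beta> (C - F)"
      using F(2) by (rule tame_meagre_subset) blast
  qed
  then have "\<tau> \<xi> closure_of C \<subseteq> F"
    using F(1) by (rule closure_of_minimal)
  then show ?thesis
    using F(2) by (blast intro: tame_meagre_subset)
qed

lemma closure_equiv_Pi0_imp_related:
  assumes E: "equiv X E" and xy: "(x, y) \<in> closure_equiv X \<tau> E \<xi>"
    and "E `` {x} \<in> Pi0 \<sigma> \<xi>" and "\<xi> < \<beta>" "\<beta> \<in> R"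
    and solid: "solid_at \<tau> \<beta> (E `` {x})" "solid_at \<tau> \<beta> (E `` {y})"
  shows "(x, y) \<in> E"
proof (rule ccontr)
  let ?C = "E `` {x}" and ?D = "E `` {y}"
  have y: "y \<in> ?D" and D: "?D \<subseteq> X"
    using xy equiv_class_self[OF E] equiv_type[OF E] by (auto simp: closure_equiv_def)
  assume "(x, y) \<notin> E"
  then have "?C \<inter> ?D = {}"
    using equiv_class_nondisjoint[OF E] by blast
  moreover have "?D \<subseteq> \<tau> \<xi> closure_of ?D"
    using D topspace_index[OF index_downward[OF assms(4,5)]] by (simp add: closure_of_subset)
  ultimately have "?D \<subseteq> \<tau> \<xi> closure_of ?C - ?C"
    using xy by (auto simp: closure_equiv_def)
  then have "tame_meagre \<tau> \<beta> ?D"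
    using solid_at_Pi0_closure_of_Diff_meagre[OF assms(3) solid(1) assms(4,5)]
    by (rule tame_meagre_subset[rotated])
  then have "?D = {}"
    using solid_at_tame_meagre_imp_empty[OF solid(2)] D topspace_index[OF assms(5)] by simp
  then show False
    using y by blast
qed

end

lemma equiv_subset_closure_equiv: "equiv X E \<Longrightarrow> E \<subseteq> closure_equiv X \<tau> E \<xi>"
  by (auto simp: closure_equiv_def equiv_class_eq_iff)

lemma below_oplus1_greaterE:
  assumes "\<xi> < \<alpha>"
  obtains \<beta> where "\<xi> < \<beta>" "\<beta> \<in> below_oplus1 \<alpha>"
proof (cases "is_successor \<alpha>")
  case True
  then show thesis
    using that assms by (simp add: below_oplus1_def)
next
  case False
  then obtain \<gamma> where "\<gamma> < \<alpha>" "\<xi> < \<gamma>"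
    using assms unfolding is_successor_def by (meson not_le)
  then show thesis
    using that False by (simp add: below_oplus1_def)
qed

lemma below_oplus1_downward: "\<xi> < \<beta> \<Longrightarrow> \<beta> \<in> below_oplus1 \<alpha> \<Longrightarrow> \<xi> \<in> below_oplus1 \<alpha>"
  unfolding below_oplus1_def by (auto split: if_splits)

theorem theorem5p1:
  fixes X :: "'a set"
    and \<sigma> :: "'a topology"
    and \<alpha> :: "'i::wellorder"
    and \<tau> :: "'i \<Rightarrow> 'a topology"
    and E :: "('a \<times> 'a) set"
  assumes "le_omega1 \<alpha>"
    and "filtration_from X \<sigma> (below_oplus1 \<alpha>) \<tau>"
    and "\<And>\<xi>. \<xi> < \<alpha> \<Longrightarrow> completely_metrizable_space (\<tau> \<xi>)"
    and "equiv X E"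
    and "\<And>C. C \<in> X // E \<Longrightarrow> solid (below_oplus1 \<alpha>) \<tau> C"
    and "\<And>C. C \<in> X // E \<Longrightarrow> C \<in> (\<Union>\<xi>\<in>{..<\<alpha>}. Pi0 \<sigma> \<xi>)"
  shows "E = (X \<times> X) \<inter> (\<Inter>\<xi>\<in>{..<\<alpha>}. closure_equiv X \<tau> E \<xi>)"
proof
  show "E \<subseteq> (X \<times> X) \<inter> (\<Inter>\<xi>\<in>{..<\<alpha>}. closure_equiv X \<tau> E \<xi>)"
    by (intro Int_greatest INT_greatest equiv_type equiv_subset_closure_equiv assms(4))
  interpret filtration X \<sigma> "below_oplus1 \<alpha>" \<tau>
    using assms(2) below_oplus1_downward by unfold_locales
  show "(X \<times> X) \<inter> (\<Inter>\<xi>\<in>{..<\<alpha>}. closure_equiv X \<tau> E \<xi>) \<subseteq> E"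
  proof (rule subrelI)
    fix x y assume xy: "(x, y) \<in> (X \<times> X) \<inter> (\<Inter>\<xi>\<in>{..<\<alpha>}. closure_equiv X \<tau> E \<xi>)"
    then have classes: "E `` {x} \<in> X // E" "E `` {y} \<in> X // E"
      by (auto intro: quotientI)
    obtain \<xi> where \<xi>: "\<xi> < \<alpha>" "E `` {x} \<in> Pi0 \<sigma> \<xi>"
      using assms(6)[OF classes(1)] by blast
    obtain \<beta> where \<beta>: "\<xi> < \<beta>" "\<beta> \<in> below_oplus1 \<alpha>"
      using below_oplus1_greaterE[OF \<xi>(1)] .
    have "solid_at \<tau> \<beta> (E `` {x})" "solid_at \<tau> \<beta> (E `` {y})"
      using assms(5) classes \<beta>(2) unfolding solid_def by blast+
    with xy \<xi> \<beta> show "(x, y) \<in> E"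
      by (blast intro: closure_equiv_Pi0_imp_related[OF assms(4)])
  qed
qed

end
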